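(* Assume there exists a family $\mathcal U$ consisting of strictly less than continuum many countable linear spaces, such that every countable linear space embeds into some $U\in\mathcal U$. Then every finite linear space embeds into a finite projective plane.
   Context: A linear space is a pair $\langle X,\mathcal L\rangle$ where $X$ is a set (of points) and $\mathcal L$ is a family of subsets of $X$ (lines) such that every line has at least two points and any two different points lie on exactly one common line. Points are collinear if some line contains all of them. An embedding of linear spaces is an injective map $f$ such that any three pairwise distinct points are collinear if and only if their images are collinear. A set of points is independent if no three pairwise distinct points of it are collinear. A linear space is a closed plane if every two of its lines intersect; it is non-degenerate if it contains an independent set with at least $4$ elements; a projective plane is a non-degenerate closed plane. *)

theory Defs
  imports Complex_Main "HOL-Library.Countable_Set" "HOL-Library.Equipollence"
begin

type_synonym 'a space = "'a set \<times> 'a set set"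

abbreviation points :: "'a space \<Rightarrow> 'a set" where
  "points S \<equiv> fst S"

abbreviation lines :: "'a space \<Rightarrow> 'a set set" where
  "lines S \<equiv> snd S"

definition linear_space :: "'a space \<Rightarrow> bool" where
  "linear_space S \<longleftrightarrow>
     (\<forall>l\<in>lines S. l \<subseteq> points S) \<and>
     (\<forall>l\<in>lines S. \<exists>x\<in>l. \<exists>y\<in>l. x \<noteq> y) \<and>
     (\<forall>x\<in>points S. \<forall>y\<in>points S. x \<noteq> y \<longrightarrow> (\<exists>!l. l \<in> lines S \<and> x \<in> l \<and> y \<in> l))"

definition collinear_in :: "'a space \<Rightarrow> 'a set \<Rightarrow> bool" where
  "collinear_in S A \<longleftrightarrow> (\<exists>l\<in>lines S. A \<subseteq> l)"

definition embedding :: "('a \<Rightarrow> 'b) \<Rightarrow> 'a space \<Rightarrow> 'b space \<Rightarrow> bool" where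
  "embedding f S T \<longleftrightarrow>
     f ` points S \<subseteq> points T \<and> inj_on f (points S) \<and>
     (\<forall>x\<in>points S. \<forall>y\<in>points S. \<forall>z\<in>points S.
        x \<noteq> y \<and> y \<noteq> z \<and> x \<noteq> z \<longrightarrow>
        (collinear_in S {x, y, z} \<longleftrightarrow> collinear_in T {f x, f y, f z}))"

definition embeds_into :: "'a space \<Rightarrow> 'b space \<Rightarrow> bool" where
  "embeds_into S T \<longleftrightarrow> (\<exists>f. embedding f S T)"

definition independent_in :: "'a space \<Rightarrow> 'a set \<Rightarrow> bool" where
  "independent_in S A \<longleftrightarrow>
     A \<subseteq> points S \<and>
     (\<forall>x\<in>A. \<forall>y\<in>A. \<forall>z\<in>A.
        x \<noteq> y \<and> y \<noteq> z \<and> x \<noteq> z \<longrightarrow> \<not> collinear_in S {x, y, z})"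

definition closed_plane :: "'a space \<Rightarrow> bool" where
  "closed_plane S \<longleftrightarrow>
     linear_space S \<and> (\<forall>l\<in>lines S. \<forall>m\<in>lines S. l \<inter> m \<noteq> {})"

text \<open>The disjunct \<open>infinite A\<close> is needed because \<open>card\<close> is \<open>0\<close> on infinite sets.\<close>

definition nondegenerate :: "'a space \<Rightarrow> bool" where
  "nondegenerate S \<longleftrightarrow> (\<exists>A. independent_in S A \<and> (infinite A \<or> card A \<ge> 4))"

definition projective_plane :: "'a space \<Rightarrow> bool" where
  "projective_plane S \<longleftrightarrow> closed_plane S \<and> nondegenerate S"

definition countable_linear_space :: "'a space \<Rightarrow> bool" where
  "countable_linear_space S \<longleftrightarrow> linear_space S \<and> countable (points S)"

definition finite_linear_space :: "'a space \<Rightarrow> bool" where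
  "finite_linear_space S \<longleftrightarrow> linear_space S \<and> finite (points S)"

definition finite_projective_plane :: "'a space \<Rightarrow> bool" where
  "finite_projective_plane S \<longleftrightarrow> projective_plane S \<and> finite (points S)"

text \<open>
  HOL cannot quantify over types inside a formula, so ``every countable linear space'' ranges
  over the spaces with points in \<open>nat\<close>, which represent all countable spaces up to isomorphism.
\<close>

definition universal_family :: "'a space set \<Rightarrow> bool" where
  "universal_family \<U> \<longleftrightarrow>
     (\<forall>S :: nat space. countable_linear_space S \<longrightarrow> (\<exists>U\<in>\<U>. embeds_into S U))"

end

theory Submission imports Defs begin

text \<open>
  No family of fewer than continuum many countable linear spaces is universal, so the hypotheses
  of the theorem contradict one another. The reason is that there are continuum many countable
  linear spaces \<open>coded_space S\<close>, one for each set \<open>S\<close> of natural numbers, all generated by the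
  same nine points through the same construction steps.

  The points of \<open>coded_space S\<close> are the natural numbers. Whatever \<open>S\<close> is, each point \<open>m \<ge> 9\<close> is
  the intersection of the line through \<open>m - 3\<close> and \<open>m - 2\<close> with the line through \<open>m - 9\<close> and
  \<open>m - 5\<close>. An embedding \<open>f\<close> into a linear space \<open>U\<close> must send \<open>m\<close> to the unique common point of
  the images of these two lines, so \<open>f\<close> is determined by its values at \<open>0, \<dots>, 8\<close>
  (\<open>embedding_determined_by_base\<close>). The set \<open>S\<close> is recorded by the collinearity of further
  triples, and collinearity can be read off in \<open>U\<close>. So \<open>U\<close> together with nine points of it
  determines \<open>S\<close> (\<open>code_recoverable\<close>). If \<open>U\<close> is countable there are only countably many choices
  of nine points, hence a universal family \<open>\<U>\<close> of countable spaces would give an injection from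
  the sets of natural numbers into \<open>\<U> \<times> \<nat>\<close>, which forces \<open>\<U>\<close> to have at least continuum
  many members.
\<close>

section \<open>Linear spaces\<close>

lemma lines_meet_at_most_once:
  assumes "linear_space U" "k \<in> lines U" "l \<in> lines U" "x \<noteq> y"
    and "x \<in> k" "y \<in> k" "x \<in> l" "y \<in> l"
  shows "k = l"
proof -
  have "k \<subseteq> points U"
    using assms(1,2) by (simp add: linear_space_def)
  then have "x \<in> points U" "y \<in> points U"
    using assms(5,6) by auto
  then have "\<exists>!l. l \<in> lines U \<and> x \<in> l \<and> y \<in> l"
    using assms(1,4) by (simp add: linear_space_def)
  then show ?thesis
    using assms(2,3,5-8) by metis
qed

text \<open>
  Here \<open>p\<close> and \<open>q\<close> both lie on the line \<open>ab\<close> and on the line \<open>cd\<close>, and these lines are different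
  because \<open>a\<close>, \<open>b\<close>, \<open>c\<close> are not collinear.
\<close>

lemma intersection_unique:
  assumes U: "linear_space U"
    and "collinear_in U {a, b, p}" "collinear_in U {a, b, q}" "a \<noteq> b"
    and "collinear_in U {c, d, p}" "collinear_in U {c, d, q}" "c \<noteq> d"
    and ncol: "\<not> collinear_in U {a, b, c}"
  shows "p = q"
proof (rule ccontr)
  assume pq: "p \<noteq> q"
  obtain k where k: "k \<in> lines U" "{a, b, p} \<subseteq> k"
    using assms(2) unfolding collinear_in_def by blast
  obtain k' where k': "k' \<in> lines U" "{a, b, q} \<subseteq> k'"
    using assms(3) unfolding collinear_in_def by blast
  obtain l where l: "l \<in> lines U" "{c, d, p} \<subseteq> l"
    using assms(5) unfolding collinear_in_def by blast
  obtain l' where l': "l' \<in> lines U" "{c, d, q} \<subseteq> l'"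
    using assms(6) unfolding collinear_in_def by blast
  have "k = k'"
    using lines_meet_at_most_once[OF U, of k k' a b] k k' \<open>a \<noteq> b\<close> by simp
  moreover have "l = l'"
    using lines_meet_at_most_once[OF U, of l l' c d] l l' \<open>c \<noteq> d\<close> by simp
  ultimately have "k = l"
    using lines_meet_at_most_once[OF U, of k l p q] k k' l l' pq by simp
  then have "{a, b, c} \<subseteq> k" using k l by simp
  then show False using k ncol unfolding collinear_in_def by blast
qed

text \<open>Two-point lines turn any partial linear space into a linear space.\<close>

definition completion :: "'a set \<Rightarrow> 'a set set \<Rightarrow> 'a space" where
  "completion V B =
     (V, B \<union> {{x, y} | x y. x \<in> V \<and> y \<in> V \<and> x \<noteq> y \<and> \<not> (\<exists>b\<in>B. x \<in> b \<and> y \<in> b)})"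

lemma linear_space_completion:
  assumes sub: "\<And>b. b \<in> B \<Longrightarrow> b \<subseteq> V"
    and two: "\<And>b. b \<in> B \<Longrightarrow> \<exists>x\<in>b. \<exists>y\<in>b. x \<noteq> y"
    and meet: "\<And>b c x y. \<lbrakk>b \<in> B; c \<in> B; x \<noteq> y; x \<in> b; y \<in> b; x \<in> c; y \<in> c\<rbrakk> \<Longrightarrow> b = c"
  shows "linear_space (completion V B)"
proof -
  let ?C = "completion V B"
  have line_iff: "l \<in> lines ?C \<longleftrightarrow> l \<in> B \<or>
      (\<exists>x y. l = {x, y} \<and> x \<in> V \<and> y \<in> V \<and> x \<noteq> y \<and> \<not> (\<exists>b\<in>B. x \<in> b \<and> y \<in> b))" for l
    unfolding completion_def by simp
  have points: "points ?C = V"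
    by (simp add: completion_def)
  have "l \<subseteq> V \<and> (\<exists>x\<in>l. \<exists>y\<in>l. x \<noteq> y)" if "l \<in> lines ?C" for l
    using that unfolding line_iff
  proof (elim disjE exE conjE)
    assume "l \<in> B"
    then show ?thesis by (intro conjI sub two)
  next
    fix x y assume l: "l = {x, y}" and "x \<in> V" "y \<in> V" "x \<noteq> y"
    then show ?thesis unfolding l by (intro conjI bexI[of _ x] bexI[of _ y]) simp_all
  qed
  moreover have "\<exists>!l. l \<in> lines ?C \<and> x \<in> l \<and> y \<in> l" if xy: "x \<in> V" "y \<in> V" "x \<noteq> y" for x y
  proof (cases "\<exists>b\<in>B. x \<in> b \<and> y \<in> b")
    case True
    then obtain b where b: "b \<in> B" "x \<in> b" "y \<in> b" by blast
    have unique: "l = b" if l: "l \<in> lines ?C" "x \<in> l" "y \<in> l" for l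
      using l(1) unfolding line_iff
    proof (elim disjE exE conjE)
      assume "l \<in> B"
      then show ?thesis using meet[of l b x y] b xy(3) l(2,3) by simp
    next
      fix u v assume "l = {u, v}" "\<not> (\<exists>b\<in>B. u \<in> b \<and> v \<in> b)"
      then show ?thesis using b l(2,3) xy(3) by auto
    qed
    have "b \<in> lines ?C" unfolding line_iff using b(1) by (rule disjI1)
    with b(2,3) show ?thesis by (intro ex1I[of _ b]) (simp, elim conjE, rule unique)
  next
    case False
    have unique: "l = {x, y}" if l: "l \<in> lines ?C" "x \<in> l" "y \<in> l" for l
      using l(1) unfolding line_iff
    proof (elim disjE exE conjE)
      assume "l \<in> B"
      then show ?thesis using False l(2,3) by blast
    next
      fix u v assume "l = {u, v}"
      then show ?thesis using l(2,3) xy(3) by auto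
    qed
    have "{x, y} \<in> lines ?C" unfolding line_iff using xy False by blast
    then show ?thesis by (intro ex1I[of _ "{x, y}"]) (simp, elim conjE, rule unique)
  qed
  ultimately show ?thesis
    unfolding linear_space_def points by simp
qed

lemma collinear_in_completion:
  assumes "x \<noteq> y" "y \<noteq> z" "x \<noteq> z"
  shows "collinear_in (completion V B) {x, y, z} \<longleftrightarrow> (\<exists>b\<in>B. {x, y, z} \<subseteq> b)"
  using assms unfolding collinear_in_def completion_def by auto

section \<open>Coding a set of natural numbers in a linear space\<close>

definition triple :: "nat \<Rightarrow> nat \<Rightarrow> nat \<Rightarrow> nat set" where
  "triple d e n = {n, n + d, n + e}"

text \<open>
  The positive differences within \<open>{0, 1, 3}\<close>, within \<open>{0, 4, 9}\<close> and within \<open>{0, 6, 13}\<close> are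
  \<open>1, 2, 3\<close> and \<open>4, 5, 9\<close> and \<open>6, 7, 13\<close>. They are all different, so the difference of two
  points of a block determines the kind of block and the place of the two points in it; hence two
  points lie in at most one block. The translates of the first two kinds generate all points from
  \<open>0, \<dots>, 8\<close>; those of the third kind carry the code.
\<close>

definition blocks :: "nat set \<Rightarrow> nat set set" where
  "blocks S = range (triple 1 3) \<union> range (triple 4 9) \<union> triple 6 13 ` S"

definition coded_space :: "nat set \<Rightarrow> nat space" where
  "coded_space S = completion UNIV (blocks S)"

lemma points_coded_space [simp]: "points (coded_space S) = UNIV"
  by (simp add: coded_space_def completion_def)

lemma blocks_meet_at_most_once:
  assumes "b \<in> blocks S" "c \<in> blocks S" "x \<noteq> y" "x \<in> b" "y \<in> b" "x \<in> c" "y \<in> c"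
  shows "b = c"
proof -
  (* The only block that can contain x < y, read off from the difference y - x. *)
  define block_through where "block_through x y =
    (if y - x = 1 then triple 1 3 x else if y - x = 2 then triple 1 3 (x - 1)
     else if y - x = 3 then triple 1 3 x else if y - x = 4 then triple 4 9 x
     else if y - x = 5 then triple 4 9 (x - 4) else if y - x = 9 then triple 4 9 x
     else if y - x = 6 then triple 6 13 x else if y - x = 7 then triple 6 13 (x - 6)
     else triple 6 13 x)" for x y
  have place: "x = n \<and> y - x = d \<or> x = n \<and> y - x = e \<or> x = n + d \<and> y - x = e - d"
    if "x \<in> triple d e n" "y \<in> triple d e n" "x < y" "0 < d" "d < e" for x y d e n
    using that unfolding triple_def by (elim insertE emptyE) simp_all
  have through: "b = block_through x y" if "b \<in> blocks S" "x < y" "x \<in> b" "y \<in> b" for b x y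
  proof -
    from \<open>b \<in> blocks S\<close> consider n where "b = triple 1 3 n" | n where "b = triple 4 9 n"
      | n where "b = triple 6 13 n"
      unfolding blocks_def by blast
    then show ?thesis
    proof cases
      case (1 n)
      have "x = n \<and> y - x = 1 \<or> x = n \<and> y - x = 3 \<or> x = n + 1 \<and> y - x = 3 - 1"
        using that unfolding 1 by (intro place) simp_all
      then show ?thesis
        unfolding 1 by (elim disjE conjE) (simp_all add: block_through_def)
    next
      case (2 n)
      have "x = n \<and> y - x = 4 \<or> x = n \<and> y - x = 9 \<or> x = n + 4 \<and> y - x = 9 - 4"
        using that unfolding 2 by (intro place) simp_all
      then show ?thesis
        unfolding 2 by (elim disjE conjE) (simp_all add: block_through_def)
    next
      case (3 n)
      have "x = n \<and> y - x = 6 \<or> x = n \<and> y - x = 13 \<or> x = n + 6 \<and> y - x = 13 - 6"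
        using that unfolding 3 by (intro place) simp_all
      then show ?thesis
        unfolding 3 by (elim disjE conjE) (simp_all add: block_through_def)
    qed
  qed
  have *: "b = c" if "x < y" "x \<in> b" "y \<in> b" "x \<in> c" "y \<in> c" for x y
    using through[of b x y] through[of c x y] assms(1,2) that by simp
  show ?thesis
    using *[of x y] *[of y x] assms by (cases x y rule: linorder_cases) auto
qed

lemma countable_linear_space_coded_space: "countable_linear_space (coded_space S)"
proof -
  have two: "\<exists>x\<in>triple d e n. \<exists>y\<in>triple d e n. x \<noteq> y" if "0 < d" for d e n
    using that by (intro bexI[of _ n] bexI[of _ "n + d"]) (simp_all add: triple_def)
  have "linear_space (coded_space S)"
    unfolding coded_space_def
  proof (rule linear_space_completion)
    show "\<exists>x\<in>b. \<exists>y\<in>b. x \<noteq> y" if "b \<in> blocks S" for b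
      using that unfolding blocks_def by (elim UnE imageE; hypsubst) (intro two; simp)+
  qed (rule subset_UNIV, rule blocks_meet_at_most_once)
  then show ?thesis
    by (simp add: countable_linear_space_def)
qed

lemma collinear_in_coded_space:
  assumes "x \<noteq> y" "y \<noteq> z" "x \<noteq> z"
  shows "collinear_in (coded_space S) {x, y, z} \<longleftrightarrow>
    (\<exists>n. {x, y, z} \<subseteq> triple 1 3 n) \<or> (\<exists>n. {x, y, z} \<subseteq> triple 4 9 n) \<or>
    (\<exists>n\<in>S. {x, y, z} \<subseteq> triple 6 13 n)"
  unfolding coded_space_def collinear_in_completion[OF assms] blocks_def
  by (simp only: bex_Un bex_simps(7) bex_UNIV disj_assoc)

lemma collinear_code_iff: "collinear_in (coded_space S) {n, n + 6, n + 13} \<longleftrightarrow> n \<in> S"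
  by (subst collinear_in_coded_space) (auto simp: triple_def)

text \<open>
  The three collinearity facts that make \<open>m + 9\<close> the intersection point of the line through
  \<open>m + 6\<close> and \<open>m + 7\<close> and the line through \<open>m\<close> and \<open>m + 4\<close>.
\<close>

lemma collinear_step:
  shows "collinear_in (coded_space S) {m + 6, m + 7, m + 9}"
    and "collinear_in (coded_space S) {m, m + 4, m + 9}"
    and "\<not> collinear_in (coded_space S) {m + 6, m + 7, m}"
proof -
  have "{m + 6, m + 7, m + 9} \<subseteq> triple 1 3 (m + 6)" by (simp add: triple_def)
  then show "collinear_in (coded_space S) {m + 6, m + 7, m + 9}"
    by (subst collinear_in_coded_space) (simp, simp, simp, blast)
  have "{m, m + 4, m + 9} \<subseteq> triple 4 9 m" by (simp add: triple_def)
  then show "collinear_in (coded_space S) {m, m + 4, m + 9}"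
    by (subst collinear_in_coded_space) (simp, simp, simp, blast)
  show "\<not> collinear_in (coded_space S) {m + 6, m + 7, m}"
    by (subst collinear_in_coded_space) (auto simp: triple_def)
qed

section \<open>Embeddings of the coding spaces\<close>

lemma embedding_coded_space_collinear_iff:
  assumes "embedding f (coded_space S) U" "x \<noteq> y" "y \<noteq> z" "x \<noteq> z"
  shows "collinear_in U {f x, f y, f z} \<longleftrightarrow> collinear_in (coded_space S) {x, y, z}"
  using assms unfolding embedding_def by simp

text \<open>
  Both \<open>f\<close> and \<open>g\<close> send the point \<open>m + 9\<close> to the intersection of two lines of \<open>U\<close> that are given
  by the images of smaller points. The codes \<open>S\<close> and \<open>T\<close> may differ, because the construction steps
  do not depend on the code.
\<close>

lemma embedding_determined_by_base:
  assumes U: "linear_space U"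
    and f: "embedding f (coded_space S) U" and g: "embedding g (coded_space T) U"
    and base: "\<And>i. i < 9 \<Longrightarrow> f i = g i"
  shows "f n = g n"
proof (induction n rule: less_induct)
  case (less n)
  show ?case
  proof (cases "n < 9")
    case False
    then obtain m where n: "n = m + 9" by (metis add.commute le_Suc_ex not_less)
    have eq: "g (m + 6) = f (m + 6)" "g (m + 7) = f (m + 7)" "g m = f m" "g (m + 4) = f (m + 4)"
      using less n by simp_all
    have "inj f" using f by (simp add: embedding_def)
    then have neq: "f (m + 6) \<noteq> f (m + 7)" "f m \<noteq> f (m + 4)" by (simp_all add: inj_eq)
    have "collinear_in U {f (m + 6), f (m + 7), f (m + 9)}"
      using embedding_coded_space_collinear_iff[OF f, of "m + 6" "m + 7" "m + 9"]
        collinear_step(1) by simp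
    moreover have "collinear_in U {f (m + 6), f (m + 7), g (m + 9)}"
      using embedding_coded_space_collinear_iff[OF g, of "m + 6" "m + 7" "m + 9"]
        collinear_step(1) eq by simp
    moreover have "collinear_in U {f m, f (m + 4), f (m + 9)}"
      using embedding_coded_space_collinear_iff[OF f, of "m" "m + 4" "m + 9"]
        collinear_step(2) by simp
    moreover have "collinear_in U {f m, f (m + 4), g (m + 9)}"
      using embedding_coded_space_collinear_iff[OF g, of "m" "m + 4" "m + 9"]
        collinear_step(2) eq by simp
    moreover have "\<not> collinear_in U {f (m + 6), f (m + 7), f m}"
      using embedding_coded_space_collinear_iff[OF f, of "m + 6" "m + 7" "m"]
        collinear_step(3) by simp
    ultimately show ?thesis
      unfolding n using intersection_unique[OF U] neq by blast
  qed (simp add: base)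
qed

lemma code_recoverable:
  assumes "linear_space U"
    and f: "embedding f (coded_space S) U" and g: "embedding g (coded_space T) U"
    and "\<And>i. i < 9 \<Longrightarrow> f i = g i"
  shows "S = T"
proof -
  have "f = g" using embedding_determined_by_base assms by blast
  then have "n \<in> S \<longleftrightarrow> n \<in> T" for n
    using embedding_coded_space_collinear_iff[OF f, of n "n + 6" "n + 13"]
      embedding_coded_space_collinear_iff[OF g, of n "n + 6" "n + 13"]
    by (simp add: collinear_code_iff)
  then show ?thesis by blast
qed

section \<open>Cardinality\<close>

text \<open>An infinite factor \<open>A\<close> absorbs \<open>\<nat>\<close>; a finite one contradicts Cantor's theorem.\<close>

lemma nat_sets_lepoll_if_lepoll_times_nat:
  assumes "(UNIV :: nat set set) \<lesssim> A \<times> (UNIV :: nat set)"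
  shows "(UNIV :: nat set set) \<lesssim> A"
proof (cases "finite A")
  case True
  then have "countable (A \<times> (UNIV :: nat set))" by (simp add: countable_finite)
  then have "countable (UNIV :: nat set set)"
    using assms unfolding lepoll_def by (metis countable_image_inj_on countable_subset)
  then obtain h :: "nat set \<Rightarrow> nat" where "inj h" unfolding countable_def by blast
  then have "surj (inv h)" by (rule inj_imp_surj_inv)
  moreover have "\<not> surj (inv h)" using Cantors_theorem[of UNIV] by (metis Pow_UNIV)
  ultimately show ?thesis by blast
next
  case False
  have "(card_of (A \<times> (UNIV :: nat set)), card_of A) \<in> ordIso"
    using False by (intro card_of_Times_infinite_simps(1)) (simp_all flip: infinite_iff_card_of_nat)
  then have "A \<times> (UNIV :: nat set) \<lesssim> A"
    unfolding lepoll_def card_of_ordLeq by (rule ordIso_iff_ordLeq[THEN iffD1, THEN conjunct1])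
  with assms show ?thesis by (rule lepoll_trans)
qed

text \<open>A real number is determined by the set of rational numbers below it.\<close>

lemma reals_lepoll_nat_sets: "(UNIV :: real set) \<lesssim> (UNIV :: nat set set)"
proof -
  have "inj (\<lambda>x :: real. to_nat ` {q :: rat. of_rat q < x})"
  proof (rule linorder_injI)
    fix x y :: real assume "x < y"
    then obtain q :: rat where "x < of_rat q" "of_rat q < y" using of_rat_dense by blast
    then have "q \<notin> {q :: rat. of_rat q < x}" "q \<in> {q :: rat. of_rat q < y}" by simp_all
    then have "{q :: rat. of_rat q < x} \<noteq> {q. of_rat q < y}" by blast
    then show "to_nat ` {q :: rat. of_rat q < x} \<noteq> to_nat ` {q :: rat. of_rat q < y}"
      by (simp add: inj_image_eq_iff)
  qed
  then show ?thesis unfolding lepoll_def by blast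
qed

text \<open>
  Choose for each \<open>S\<close> a member of \<open>\<U>\<close> into which \<open>coded_space S\<close> embeds, and a natural number
  coding the images of the nine base points; by \<open>code_recoverable\<close> this pair determines \<open>S\<close>.
\<close>

lemma universal_family_lepoll:
  assumes count: "\<And>U. U \<in> \<U> \<Longrightarrow> countable_linear_space U"
    and univ: "universal_family \<U>"
  shows "(UNIV :: real set) \<lesssim> \<U>"
proof -
  have "\<exists>U f. U \<in> \<U> \<and> embedding f (coded_space S) U" for S
    using univ countable_linear_space_coded_space
    unfolding universal_family_def embeds_into_def by blast
  then obtain U f where U: "U S \<in> \<U>" and f: "embedding (f S) (coded_space S) (U S)" for S
    by metis
  (* The number coding the images of the nine base points. *)
  define c where "c S = to_nat (map (to_nat_on (points (U S)) \<circ> f S) [0..<9])" for S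
  have "inj (\<lambda>S. (U S, c S))"
  proof (rule injI)
    fix S T assume eq: "(U S, c S) = (U T, c T)"
    have cU: "linear_space (U S)" "countable (points (U S))"
      using count[OF U] unfolding countable_linear_space_def by auto
    have "f S i = f T i" if "i < 9" for i
    proof -
      have "to_nat_on (points (U S)) (f S i) = to_nat_on (points (U S)) (f T i)"
        using eq that by (auto simp: c_def map_eq_conv)
      moreover have "f S i \<in> points (U S)" "f T i \<in> points (U S)"
        using f[of S] f[of T] eq unfolding embedding_def by auto
      ultimately show ?thesis using cU(2) by simp
    qed
    moreover have "embedding (f T) (coded_space T) (U S)" using f[of T] eq by simp
    ultimately show "S = T" using code_recoverable[OF cU(1) f] by blast
  qed
  then have "(UNIV :: nat set set) \<lesssim> \<U> \<times> (UNIV :: nat set)"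
    unfolding lepoll_def using U by blast
  then show ?thesis
    using nat_sets_lepoll_if_lepoll_times_nat reals_lepoll_nat_sets lepoll_trans by blast
qed

theorem theorem4p17:
  fixes \<U> :: "'a space set" and P :: "'b space"
  assumes "\<U> \<prec> (UNIV :: real set)"
    and "\<And>U. U \<in> \<U> \<Longrightarrow> countable_linear_space U"
    and "universal_family \<U>"
    and "finite_linear_space P"
  shows "\<exists>Q :: nat space. finite_projective_plane Q \<and> embeds_into P Q"
proof -
  have "(UNIV :: real set) \<lesssim> \<U>"
    using assms(2,3) by (rule universal_family_lepoll)
  moreover have "\<U> \<lesssim> (UNIV :: real set)" "\<not> \<U> \<approx> (UNIV :: real set)"
    using assms(1) by (simp_all add: lesspoll_def)
  ultimately show ?thesis
    using lepoll_antisym by blast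
qed

end
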